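(* Let $\langle\chi,\vec a\rangle$ be a loop and $\check\phi$ a quantifier-free formula over $\vec x$, where $\chi(\vec x)\equiv\bigwedge_{i=1}^k C_i$ in CNF and each clause $C_i$ contains an inequation $e_i(\vec x)>0$ (as one of its disjuncts) such that \[ \check\phi(\vec x)\land e_i(\vec x)\ge e_i(\vec a(\vec x))\implies e_i(\vec a(\vec x))\ge e_i(\vec a^2(\vec x)) \] is valid. Then the conditional acceleration technique mapping $(\langle\chi,\vec a\rangle,\check\phi)$ to \[ \vec x'=\vec a^n(\vec x)\land\bigwedge_{i=1}^k\bigl(e_i(\vec x)>0\land e_i(\vec a^{n-1}(\vec x))>0\bigr) \] is sound. If moreover $C_i\equiv e_i>0$ for all $i\in[1,k]$, then it is exact.
   Context: Fix $d\ge 1$, integer variables $\vec x=(x_1,\dots,x_d)$, $\vec x'$, and $n$ ranging over $\mathbb N$; $\vec y=(\vec x,n,\vec x')$. A loop $\langle\chi,\vec a\rangle$ consists of a quantifier-free formula $\chi$ over atoms $p>0$ ($p$ an arithmetic expression over $\vec x$, integer semantics) and a map $\vec a:\mathbb Z^d\to\mathbb Z^d$ given by expressions over $\vec x$; $\vec a^m$ is $m$-fold application. $\vec x\longrightarrow_{\langle\chi,\vec a\rangle}\vec x'$ iff $\chi(\vec x)\land\vec x'=\vec a(\vec x)$, and $\longrightarrow^m$ is its $m$-fold composition. For a pair $(\langle\chi,\vec a\rangle,\check\phi)$ and a formula $\psi$ over $\vec y$ assigned to it, soundness means: for all $\vec x,\vec x'\in\mathbb Z^d$ and all $n>0$, $\vec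 x\longrightarrow^n_{\langle\check\phi,\vec a\rangle}\vec x'\land\psi$ implies $\vec x\longrightarrow^n_{\langle\chi,\vec a\rangle}\vec x'$; exactness means soundness plus: $\vec x\longrightarrow^n_{\langle\chi\land\check\phi,\vec a\rangle}\vec x'$ implies $\psi$. Validity means truth for all integer values of the free variables. *)

theory Defs
  imports "HOL-Analysis.Finite_Cartesian_Product"
begin

text \<open>
  A point of \<open>\<int>\<^sup>d\<close> has type \<^typ>\<open>int ^ 'd\<close> for a finite (hence nonempty) index type \<open>'d\<close>,
  so \<open>d \<ge> 1\<close> is built in. An expression is represented by the integer-valued function it
  denotes; no particular grammar of arithmetic operations is fixed.
\<close>

type_synonym 'd point = "int ^ 'd"
type_synonym 'd expr = "'d point \<Rightarrow> int"

text \<open>Quantifier-free formulas; \<open>Pos p\<close> is the atom \<open>p > 0\<close>.\<close>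

datatype 'd qf =
    Pos "'d expr"
  | Tru
  | Fls
  | Neg "'d qf"
  | And "'d qf" "'d qf"
  | Or "'d qf" "'d qf"

primrec holds :: "'d qf \<Rightarrow> 'd point \<Rightarrow> bool" where
  "holds (Pos p) x \<longleftrightarrow> p x > 0"
| "holds Tru x \<longleftrightarrow> True"
| "holds Fls x \<longleftrightarrow> False"
| "holds (Neg f) x \<longleftrightarrow> \<not> holds f x"
| "holds (And f g) x \<longleftrightarrow> holds f x \<and> holds g x"
| "holds (Or f g) x \<longleftrightarrow> holds f x \<or> holds g x"

definition qf_equiv :: "'d qf \<Rightarrow> 'd qf \<Rightarrow> bool" where
  "qf_equiv f g \<longleftrightarrow> (\<forall>x. holds f x \<longleftrightarrow> holds g x)"

definition big_and :: "'d qf list \<Rightarrow> 'd qf" where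
  "big_and fs = foldr And fs Tru"

definition big_or :: "'d qf list \<Rightarrow> 'd qf" where
  "big_or fs = foldr Or fs Fls"

definition literal :: "'d qf \<Rightarrow> bool" where
  "literal f \<longleftrightarrow> (\<exists>p. f = Pos p \<or> f = Neg (Pos p))"

text \<open>A clause is given by the list of its disjuncts.\<close>

definition clause :: "'d qf list \<Rightarrow> bool" where
  "clause C \<longleftrightarrow> (\<forall>l \<in> set C. literal l)"

definition cnf :: "nat \<Rightarrow> (nat \<Rightarrow> 'd qf list) \<Rightarrow> 'd qf" where
  "cnf k C = big_and (map (\<lambda>i. big_or (C i)) [1..<Suc k])"

type_synonym 'd loop = "'d qf \<times> ('d point \<Rightarrow> 'd point)"

fun loop_step :: "'d loop \<Rightarrow> 'd point \<Rightarrow> 'd point \<Rightarrow> bool" where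
  "loop_step (chi, a) x x' \<longleftrightarrow> holds chi x \<and> x' = a x"

text \<open>
  A formula over \<open>(x, n, x')\<close> is represented by the predicate it denotes, since the expressions
  \<open>a\<^sup>n(x)\<close> depend on the parameter \<open>n\<close>.
\<close>

type_synonym 'd trans_formula = "'d point \<Rightarrow> nat \<Rightarrow> 'd point \<Rightarrow> bool"

fun cond_accel_sound :: "'d loop \<times> 'd qf \<Rightarrow> 'd trans_formula \<Rightarrow> bool" where
  "cond_accel_sound ((chi, a), \<phi>) \<psi> \<longleftrightarrow>
     (\<forall>x x' n. n > 0 \<longrightarrow> (loop_step (\<phi>, a) ^^ n) x x' \<and> \<psi> x n x' \<longrightarrow>
        (loop_step (chi, a) ^^ n) x x')"

fun cond_accel_exact :: "'d loop \<times> 'd qf \<Rightarrow> 'd trans_formula \<Rightarrow> bool" where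
  "cond_accel_exact ((chi, a), \<phi>) \<psi> \<longleftrightarrow>
     cond_accel_sound ((chi, a), \<phi>) \<psi> \<and>
     (\<forall>x x' n. n > 0 \<longrightarrow> (loop_step (And chi \<phi>, a) ^^ n) x x' \<longrightarrow> \<psi> x n x')"

text \<open>For \<open>n = 0\<close> the exponent \<open>n - 1\<close> is truncated, but soundness and exactness only use \<open>n > 0\<close>.\<close>

definition accel_formula ::
    "('d point \<Rightarrow> 'd point) \<Rightarrow> nat \<Rightarrow> (nat \<Rightarrow> 'd expr) \<Rightarrow> 'd trans_formula" where
  "accel_formula a k e x n x' \<longleftrightarrow>
     x' = (a ^^ n) x \<and> (\<forall>i\<in>{1..k}. e i x > 0 \<and> e i ((a ^^ (n - 1)) x) > 0)"

end

theory Submission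
  imports Defs
begin

text \<open>
  Along the orbit of \<open>x\<close>, the hypothesis on \<open>e\<^sub>i\<close> says that once the sequence
  \<open>e\<^sub>i(a\<^sup>j(x))\<close> stops growing it never grows again. Such a sequence attains its minimum over
  \<open>0, \<dots>, n - 1\<close> at one of the two ends, so positivity at both ends gives positivity throughout.
\<close>

lemma holds_big_and: "holds (big_and fs) x \<longleftrightarrow> (\<forall>f\<in>set fs. holds f x)"
  unfolding big_and_def by (induction fs) auto

lemma holds_big_or: "holds (big_or fs) x \<longleftrightarrow> (\<exists>f\<in>set fs. holds f x)"
  unfolding big_or_def by (induction fs) auto

lemma holds_cnf: "holds (cnf k C) x \<longleftrightarrow> (\<forall>i\<in>{1..k}. holds (big_or (C i)) x)"
  unfolding cnf_def holds_big_and by auto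

text \<open>The update is deterministic, so a run of length \<open>n\<close> can only be the orbit
  of \<open>x\<close>; the guard is tested at the first \<open>n\<close> orbit points, not at the
  final one.\<close>

lemma loop_step_relpowp:
  "(loop_step (chi, a) ^^ n) x x' \<longleftrightarrow>
     x' = (a ^^ n) x \<and> (\<forall>j<n. holds chi ((a ^^ j) x))"
proof (induction n arbitrary: x')
  case 0
  then show ?case by auto
next
  case (Suc n)
  have "(loop_step (chi, a) ^^ Suc n) x x' \<longleftrightarrow>
      (\<exists>y. (loop_step (chi, a) ^^ n) x y \<and> loop_step (chi, a) y x')"
    by (auto simp: relcompp_apply)
  also have "\<dots> \<longleftrightarrow> x' = (a ^^ Suc n) x \<and> (\<forall>j<Suc n. holds chi ((a ^^ j) x))"
    unfolding Suc.IH by (auto simp: less_Suc_eq)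
  finally show ?case .
qed

text \<open>One non-increasing step forces the next, so no later step up to \<open>N\<close>
  increases. \<open>step\<close> is asked for only below \<open>N\<close> because \<phi> is known
  only along a finite run.\<close>

lemma decreasing_from:
  fixes f :: "nat \<Rightarrow> 'a::preorder"
  assumes step: "\<And>j. Suc j < N \<Longrightarrow> f (Suc j) \<le> f j \<Longrightarrow> f (Suc (Suc j)) \<le> f (Suc j)"
    and start: "f (Suc m) \<le> f m" and "m < N"
  shows "f N \<le> f (Suc m)"
proof -
  have "f (Suc p) \<le> f p \<and> f (Suc p) \<le> f (Suc m)" if "m \<le> p" "p < N" for p
    using that
  proof (induction p rule: dec_induct)
    case base
    then show ?case using start by simp
  next
    case (step p)
    then show ?case using assms(1)[of p] by (auto intro: order_trans)
  qed
  \<comment> \<open>The last step below \<open>N\<close> is the one that ends at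
    \<open>N\<close>.\<close>
  from this[of "N - 1"] show ?thesis using \<open>m < N\<close> by simp
qed

text \<open>If the step into \<open>Suc m\<close> does not increase, the sequence stays
  non-increasing up to \<open>N\<close>, so \<open>f N\<close> is a lower bound; if it increases,
  the bound on \<open>f m\<close> carries over.\<close>

lemma min_ends_le:
  fixes f :: "nat \<Rightarrow> 'a::linorder"
  assumes step: "\<And>j. Suc j < N \<Longrightarrow> f (Suc j) \<le> f j \<Longrightarrow> f (Suc (Suc j)) \<le> f (Suc j)"
    and "m \<le> N"
  shows "min (f 0) (f N) \<le> f m"
  using \<open>m \<le> N\<close>
proof (induction m)
  case 0
  then show ?case by simp
next
  case (Suc m)
  show ?case
  proof (cases "f (Suc m) \<le> f m")
    case True
    then show ?thesis using decreasing_from[of N f m] step Suc.prems by (simp add: min.coboundedI2)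
  next
    case False
    then show ?thesis using Suc by simp
  qed
qed

theorem theorem11:
  fixes chi \<phi> :: "'d::finite qf"
    and a :: "'d point \<Rightarrow> 'd point"
    and k :: nat
    and C :: "nat \<Rightarrow> 'd qf list"
    and e :: "nat \<Rightarrow> 'd expr"
  assumes "\<And>i. i \<in> {1..k} \<Longrightarrow> clause (C i)"
    and "qf_equiv chi (cnf k C)"
    and "\<And>i. i \<in> {1..k} \<Longrightarrow> Pos (e i) \<in> set (C i)"
    and "\<And>i x. i \<in> {1..k} \<Longrightarrow> holds \<phi> x \<and> e i x \<ge> e i (a x) \<Longrightarrow> e i (a x) \<ge> e i ((a ^^ 2) x)"
  shows "cond_accel_sound ((chi, a), \<phi>) (accel_formula a k e) \<and>
    ((\<forall>i\<in>{1..k}. qf_equiv (big_or (C i)) (Pos (e i))) \<longrightarrow>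
       cond_accel_exact ((chi, a), \<phi>) (accel_formula a k e))"
proof -
  have sound: "cond_accel_sound ((chi, a), \<phi>) (accel_formula a k e)"
  proof (clarsimp simp: loop_step_relpowp accel_formula_def simp del: loop_step.simps)
    fix x n j
    assume "j < n" and phi: "\<forall>j<n. holds \<phi> ((a ^^ j) x)"
      and ends: "\<forall>i\<in>{Suc 0..k}. 0 < e i x \<and> 0 < e i ((a ^^ (n - Suc 0)) x)"
    have "holds (big_or (C i)) ((a ^^ j) x)" if i: "i \<in> {1..k}" for i
    proof -
      \<comment> \<open>The right end is \<open>n - 1\<close>, the last orbit point at which the
        guard is tested.\<close>
      have "min (e i ((a ^^ 0) x)) (e i ((a ^^ (n - 1)) x)) \<le> e i ((a ^^ j) x)"
      proof (rule min_ends_le)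
        fix l
        assume "Suc l < n - 1" "e i ((a ^^ Suc l) x) \<le> e i ((a ^^ l) x)"
        \<comment> \<open>The assumed implication is applied at the orbit point
          \<open>(a ^^ l) x\<close>, where \<phi> holds since \<open>l < n\<close>.\<close>
        then show "e i ((a ^^ Suc (Suc l)) x) \<le> e i ((a ^^ Suc l) x)"
          using assms(4)[OF i, of "(a ^^ l) x"] phi by (simp add: numeral_2_eq_2)
      qed (use \<open>j < n\<close> in simp)
      then have "holds (Pos (e i)) ((a ^^ j) x)"
        using ends i by (auto simp: min_le_iff_disj intro: less_le_trans)
      then show ?thesis
        using assms(3)[OF i] holds_big_or by blast
    qed
    then show "holds chi ((a ^^ j) x)"
      using assms(2) by (simp add: qf_equiv_def holds_cnf)
  qed
  moreover have "cond_accel_exact ((chi, a), \<phi>) (accel_formula a k e)"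
    if "\<forall>i\<in>{1..k}. qf_equiv (big_or (C i)) (Pos (e i))"
  proof -
    \<comment> \<open>Exactness needs this converse: in soundness a true clause need not make its
      \<open>e i\<close> positive.\<close>
    have chi: "holds chi y \<longleftrightarrow> (\<forall>i\<in>{1..k}. e i y > 0)" for y
      using assms(2) that by (simp add: qf_equiv_def holds_cnf)
    have "accel_formula a k e x n x'"
      if "n > 0" "(loop_step (And chi \<phi>, a) ^^ n) x x'" for x x' n
    proof -
      from that(2) have "x' = (a ^^ n) x" and all: "\<forall>j<n. holds chi ((a ^^ j) x)"
        by (simp_all add: loop_step_relpowp)
      \<comment> \<open>As \<open>n > 0\<close>, both \<open>0\<close> and \<open>n - 1\<close> lie
        below \<open>n\<close>, so the run tests the guard at both ends.\<close>
      moreover have "holds chi x" "holds chi ((a ^^ (n - 1)) x)"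
        using all[rule_format, of 0] all[rule_format, of "n - 1"] \<open>n > 0\<close> by simp_all
      ultimately show ?thesis by (simp add: accel_formula_def chi)
    qed
    with sound show ?thesis by simp
  qed
  ultimately show ?thesis by blast
qed

end
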